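(* Let $x=P(x)$ be a PPS in $n$ variables in simple normal form, with LFP $q^*$ satisfying $\mathbf{0} < q^* < \mathbf{1}$. Then for all $i=1,\dots,n$, $1-q^*_i \geq 2^{-4|P|}$; in other words, $\| q^* \|_{\infty} \leq 1-2^{-4|P|}$.
   Context: A PPS is a system $x_i = P_i(x)$, $i=1,\dots,n$, with each $P_i$ a polynomial with nonnegative rational coefficients (including constant term) summing to at most $1$; its LFP $q^*\in[0,1]^n$ is the coordinatewise least nonnegative solution. Simple normal form: each $P_i$ is either $x_jx_k$ or linear $\sum_j p_{i,j}x_j+p_{i,0}$ with nonnegative coefficients summing to at most $1$. $|P|$ is $n$ plus the total number of bits of all nonzero coefficients (rationals with numerator and denominator in binary) and nonzero exponents of all the polynomials. *)

theory Defs
  imports "HOL-Analysis.Analysis" "HOL-Library.Poly_Mapping" "HOL-Library.Log_Nat"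
begin

text \<open>
  The variables are indexed by a finite type \<open>'n\<close>, so a system has \<open>CARD('n)\<close> variables. A
  monomial is its finitely supported exponent vector and a polynomial is its finitely supported
  family of coefficients; the keys of a polynomial are thus its monomials with nonzero coefficient,
  and the keys of a monomial are the variables with nonzero exponent.
\<close>

type_synonym 'n monomial = "'n \<Rightarrow>\<^sub>0 nat"
type_synonym 'n rpoly = "'n monomial \<Rightarrow>\<^sub>0 rat"

definition poly_value :: "'n::finite rpoly \<Rightarrow> real ^ 'n \<Rightarrow> real" where
  "poly_value p x =
     (\<Sum>m\<in>Poly_Mapping.keys p. of_rat (Poly_Mapping.lookup p m) *
        (\<Prod>j\<in>UNIV. (x $ j) ^ Poly_Mapping.lookup m j))"

definition system_map :: "('n::finite \<Rightarrow> 'n rpoly) \<Rightarrow> real ^ 'n \<Rightarrow> real ^ 'n" where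
  "system_map P x = (\<chi> i. poly_value (P i) x)"

definition PPS :: "('n::finite \<Rightarrow> 'n rpoly) \<Rightarrow> bool" where
  "PPS P \<longleftrightarrow>
     (\<forall>i. (\<forall>m. Poly_Mapping.lookup (P i) m \<ge> 0) \<and>
          (\<Sum>m\<in>Poly_Mapping.keys (P i). Poly_Mapping.lookup (P i) m) \<le> 1)"

definition is_LFP :: "('n::finite \<Rightarrow> 'n rpoly) \<Rightarrow> real ^ 'n \<Rightarrow> bool" where
  "is_LFP P q \<longleftrightarrow>
     (\<forall>i. 0 \<le> q $ i) \<and> q = system_map P q \<and>
     (\<forall>y. (\<forall>i. 0 \<le> y $ i) \<and> y = system_map P y \<longrightarrow> (\<forall>i. q $ i \<le> y $ i))"

definition var :: "'n \<Rightarrow> 'n monomial" where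
  "var j = Poly_Mapping.single j 1"

text \<open>Monomials are multiplied by adding their exponent vectors, so \<open>j = k\<close> gives the square.\<close>

definition quadratic_form :: "'n rpoly \<Rightarrow> bool" where
  "quadratic_form p \<longleftrightarrow> (\<exists>j k. p = Poly_Mapping.single (var j + var k) 1)"

definition linear_form :: "'n::finite rpoly \<Rightarrow> bool" where
  "linear_form p \<longleftrightarrow>
     (\<exists>(a :: 'n \<Rightarrow> rat) (c :: rat).
        (\<forall>j. 0 \<le> a j) \<and> 0 \<le> c \<and> (\<Sum>j\<in>UNIV. a j) + c \<le> 1 \<and>
        p = (\<Sum>j\<in>UNIV. Poly_Mapping.single (var j) (a j)) + Poly_Mapping.single 0 c)"

definition simple_normal_form :: "('n::finite \<Rightarrow> 'n rpoly) \<Rightarrow> bool" where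
  "simple_normal_form P \<longleftrightarrow> (\<forall>i. quadratic_form (P i) \<or> linear_form (P i))"

text \<open>
  \<open>floorlog 2 k\<close> is the number of binary digits of \<open>k > 0\<close>. Rationals are encoded in lowest terms,
  which makes the size as small as possible. The coefficients of a PPS are nonnegative and need no
  sign bit; the absolute value only turns the numerator into a natural number.
\<close>

definition rat_bits :: "rat \<Rightarrow> nat" where
  "rat_bits r =
     floorlog 2 (nat \<bar>fst (quotient_of r)\<bar>) + floorlog 2 (nat (snd (quotient_of r)))"

definition encoding_size :: "('n::finite \<Rightarrow> 'n rpoly) \<Rightarrow> nat" where
  "encoding_size P =
     CARD('n) +
     (\<Sum>i\<in>UNIV. \<Sum>m\<in>Poly_Mapping.keys (P i).
        rat_bits (Poly_Mapping.lookup (P i) m) +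
        (\<Sum>j\<in>Poly_Mapping.keys m. floorlog 2 (Poly_Mapping.lookup m j)))"

end

theory Submission
  imports Defs
begin

text \<open>
  If \<open>y \<ge> 0\<close> satisfies \<open>P(y) \<le> y\<close>, then \<open>q \<le> y\<close>. We look for such a \<open>y\<close> of the form \<open>1 - v / M\<^sup>2\<close> with
  \<open>1 \<le> v \<le> M\<close>. For this it suffices that \<open>v\<close> satisfies \<open>v\<^sub>i + 1 \<le> v\<^sub>j + v\<^sub>k\<close> when \<open>P\<^sub>i = x\<^sub>j x\<^sub>k\<close>, and
  \<open>v\<^sub>i \<le> \<Sum>\<^sub>j p\<^sub>i\<^sub>j v\<^sub>j\<close> when \<open>P\<^sub>i\<close> is linear with coefficients (constant
  term included) summing to exactly \<open>1\<close>; a linear \<open>P\<^sub>i\<close> whose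
  coefficients sum to less than \<open>1\<close> has a defect of at least one over its common denominator and
  imposes nothing. These linear inequalities are solvable, as \<open>1 - q\<close> scaled up by a large factor
  shows. Hence they have a solution at a vertex, whose entries are bounded by Cramer's rule by an
  \<open>M \<le> 2\<^bsup>2|P|\<^esup>\<close>, and \<open>1 - q \<ge> 1 / M\<^sup>2\<close> follows.
\<close>

section \<open>Small solutions of integer systems of linear inequalities\<close>

text \<open>Multiplying out the row sums gives one nonnegative term for every map of the index set
  to itself; the Leibniz formula keeps, up to sign, only the terms of permutations.\<close>

lemma abs_det_le_prod_row_sums:
  fixes A :: "real^'n^'n"
  shows "\<bar>det A\<bar> \<le> (\<Prod>i\<in>UNIV. \<Sum>j\<in>UNIV. \<bar>A $ i $ j\<bar>)"
proof -
  have "\<bar>det A\<bar> \<le> (\<Sum>p | p permutes (UNIV :: 'n set). \<bar>of_int (sign p) * (\<Prod>i\<in>UNIV. A $ i $ p i)\<bar>)"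
    unfolding det_def by (rule sum_abs)
  also have "\<dots> = (\<Sum>p | p permutes (UNIV :: 'n set). \<Prod>i\<in>UNIV. \<bar>A $ i $ p i\<bar>)"
    by (intro sum.cong refl) (auto simp: abs_mult abs_prod sign_def)
  also have "\<dots> \<le> (\<Sum>p\<in>PiE UNIV (\<lambda>_. UNIV). \<Prod>i\<in>UNIV. \<bar>A $ i $ p i\<bar>)"
    by (rule sum_mono2) (auto simp: finite_PiE intro: prod_nonneg)
  also have "\<dots> = (\<Prod>i\<in>UNIV. \<Sum>j\<in>UNIV. \<bar>A $ i $ j\<bar>)"
    by (rule prod_sum_PiE[symmetric]) auto
  finally show ?thesis .
qed

lemma det_in_Ints:
  fixes A :: "'a::comm_ring_1^'n^'n"
  assumes "\<And>i j. A $ i $ j \<in> \<int>"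
  shows "det A \<in> \<int>"
  unfolding det_def using assms by (auto intro!: Ints_sum Ints_mult Ints_prod)

text \<open>A feasible point with as many tight constraints as possible: if the tight rows did not span,
  one could move along their orthogonal complement until a further constraint becomes tight.\<close>

lemma feasible_vertex_exists:
  fixes r :: "'c::finite \<Rightarrow> 'a::euclidean_space" and b :: "'c \<Rightarrow> real"
  assumes span: "span (range r) = UNIV"
    and feas: "\<And>c. b c \<le> r c \<bullet> v\<^sub>0"
  obtains v where "\<And>c. b c \<le> r c \<bullet> v" "span (r ` {c. r c \<bullet> v = b c}) = UNIV"
proof -
  define F where "F v \<longleftrightarrow> (\<forall>c. b c \<le> r c \<bullet> v)" for v
  define T where "T v = {c. r c \<bullet> v = b c}" for v
  have "\<exists>v. F v \<and> (\<forall>u. F u \<longrightarrow> card (T u) \<le> card (T v))"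
  proof (rule Lattices_Big.ex_has_greatest_nat)
    show "F v\<^sub>0" using feas by (simp add: F_def)
    show "\<forall>u. F u \<longrightarrow> card (T u) < Suc CARD('c)"
      by (simp add: less_Suc_eq_le card_mono)
  qed
  then obtain v where v: "F v" and max: "\<And>u. F u \<Longrightarrow> card (T u) \<le> card (T v)" by blast
  have "span (r ` T v) = UNIV"
  proof (rule ccontr)
    assume "span (r ` T v) \<noteq> UNIV"
    then obtain w0 where w0: "w0 \<noteq> 0" "span (r ` T v) \<subseteq> {x. w0 \<bullet> x = 0}"
      using span_not_univ_subset_hyperplane by blast
    have "\<exists>c. r c \<bullet> w0 \<noteq> 0"
    proof (rule ccontr)
      assume "\<nexists>c. r c \<bullet> w0 \<noteq> 0"
      then have "range r \<subseteq> {x. w0 \<bullet> x = 0}" by (auto simp: inner_commute)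
      then have "span (range r) \<subseteq> {x. w0 \<bullet> x = 0}"
        by (rule span_minimal) (rule subspace_hyperplane)
      with span have "w0 \<in> {x. w0 \<bullet> x = 0}" by blast
      with w0(1) show False by simp
    qed
    \<comment> \<open>Some constraint has to decrease along the direction, or moving would never
      make a new one tight; flipping the sign of \<open>w0\<close> if necessary arranges
      this.\<close>
    then obtain c0 where "r c0 \<bullet> w0 < 0 \<or> r c0 \<bullet> (- w0) < 0"
      by (metis inner_minus_right linorder_neqE_linordered_idom neg_less_0_iff_less)
    then obtain w where c0: "r c0 \<bullet> w < 0" and "w = w0 \<or> w = - w0" by blast
    then have w: "r c \<bullet> w = 0" if "c \<in> T v" for c
      using w0(2) that span_base[of "r c" "r ` T v"] by (auto simp: inner_commute)
    \<comment> \<open>\<open>t c\<close> is the step length along \<open>w\<close> at which a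
      decreasing constraint \<open>c\<close> becomes tight. The smallest one, \<open>t c1\<close>,
      keeps every constraint satisfied and makes \<open>c1\<close> tight.\<close>
    define t where "t c = (r c \<bullet> v - b c) / - (r c \<bullet> w)" for c
    define C where "C = {c. r c \<bullet> w < 0}"
    obtain c1 where c1: "c1 \<in> C" "\<And>c. c \<in> C \<Longrightarrow> t c1 \<le> t c"
      using arg_min_if_finite[of C t] c0 unfolding C_def
      by (metis (mono_tags, lifting) empty_iff finite linorder_not_le mem_Collect_eq)
    have t1: "t c1 \<ge> 0"
      using c1(1) v unfolding t_def C_def F_def by (intro divide_nonneg_nonneg) auto
    define u where "u = v + t c1 *\<^sub>R w"
    have ru: "r c \<bullet> u = r c \<bullet> v + t c1 * (r c \<bullet> w)" for c
      by (simp add: u_def inner_add_right)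
    have "F u"
      unfolding F_def
    proof
      fix c
      show "b c \<le> r c \<bullet> u"
      proof (cases "c \<in> C")
        case True
        then have neg: "- (r c \<bullet> w) > 0" by (simp add: C_def)
        have "t c1 * - (r c \<bullet> w) \<le> t c * - (r c \<bullet> w)"
          using c1(2)[OF True] neg by (intro mult_right_mono) auto
        also have "\<dots> = r c \<bullet> v - b c" using neg by (simp add: t_def)
        finally show ?thesis by (simp add: ru)
      next
        case False
        then have "t c1 * (r c \<bullet> w) \<ge> 0" using t1 by (simp add: C_def)
        moreover have "b c \<le> r c \<bullet> v" using v by (simp add: F_def)
        ultimately show ?thesis by (simp add: ru)
      qed
    qed
    moreover have "c1 \<in> T u" using c1(1) by (simp add: T_def ru t_def C_def)
    moreover have "c1 \<notin> T v" using w[of c1] c1(1) by (auto simp: C_def)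
    moreover have "T v \<subseteq> T u" using w by (auto simp: T_def ru)
    ultimately have "card (T v) < card (T u)" by (intro psubset_card_mono) auto
    with max[OF \<open>F u\<close>] show False by simp
  qed
  with v show thesis by (intro that[of v]) (auto simp: F_def T_def)
qed

text \<open>At a vertex some linearly independent tight constraints form a square integer system
  with solution \<open>v\<close>. In Cramer's rule the denominator is a nonzero integer, so only the
  numerator determinant has to be bounded.\<close>

lemma integer_system_small_solution:
  fixes r :: "'c::finite \<Rightarrow> real^'n" and b N :: "'c \<Rightarrow> real"
  assumes span: "span (range r) = UNIV"
    and feas: "\<And>c. b c \<le> r c \<bullet> v\<^sub>0"
    and int: "\<And>c j. r c $ j \<in> \<int>" "\<And>c. b c \<in> \<int>"
    and N: "\<And>c. (\<Sum>j\<in>UNIV. \<bar>r c $ j\<bar>) + \<bar>b c\<bar> \<le> N c" "\<And>c. 1 \<le> N c"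
  obtains v where "\<And>c. b c \<le> r c \<bullet> v" "\<And>k. \<bar>v $ k\<bar> \<le> prod N UNIV"
proof -
  obtain v where v: "\<And>c. b c \<le> r c \<bullet> v" and sp: "span (r ` {c. r c \<bullet> v = b c}) = UNIV"
    using feasible_vertex_exists[OF span feas] by blast
  let ?T = "{c. r c \<bullet> v = b c}"
  obtain B where B: "B \<subseteq> r ` ?T" "independent B" "r ` ?T \<subseteq> span B"
    using maximal_independent_subset by blast
  have spB: "span B = UNIV"
    using B(3) sp span_mono[OF B(3)] by (auto simp: span_span)
  have "card B = CARD('n)"
    using dim_eq_card_independent[OF B(2)] spB by (metis dim_span dim_UNIV DIM_cart DIM_real mult_1_right)
  moreover have "finite B" by (rule finite_subset[OF B(1)]) simp
  ultimately have "\<exists>f. bij_betw f (UNIV :: 'n set) B"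
    by (intro finite_same_card_bij) auto
  then obtain f where f: "bij_betw f (UNIV :: 'n set) B" ..
  \<comment> \<open>Different constraints may share a coefficient vector, so \<open>g\<close>
    selects one tight constraint for each basis vector; it inherits injectivity from
    \<open>f\<close>.\<close>
  have "\<forall>i. \<exists>c. r c = f i \<and> r c \<bullet> v = b c"
  proof
    fix i
    have "f i \<in> r ` ?T" using bij_betwE[OF f] B(1) by blast
    then show "\<exists>c. r c = f i \<and> r c \<bullet> v = b c" by (metis (mono_tags, lifting) imageE mem_Collect_eq)
  qed
  then obtain g where g: "\<And>i. r (g i) = f i" "\<And>i. r (g i) \<bullet> v = b (g i)" by metis
  have inj: "inj g"
    using f g(1) by (metis bij_betw_imp_inj_on injD injI)
  define A where "A = (\<chi> i. r (g i))"
  have "rows A = B"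
    using bij_betw_imp_surj_on[OF f] by (auto simp: rows_def row_def A_def g(1))
  then have "\<exists>A'. A' ** A = mat 1"
    using spB by (simp add: matrix_left_invertible_span_rows)
  then have dA: "det A \<noteq> 0"
    using invertible_det_nz invertible_left_inverse by blast
  have "A *v v = (\<chi> i. b (g i))"
    by (simp add: vec_eq_iff matrix_vector_mult_def A_def g(2)[symmetric] inner_vec_def)
  then have veq: "v = (\<chi> k. det (\<chi> i j. if j = k then (\<chi> i. b (g i)) $ i else A $ i $ j) / det A)"
    using cramer[OF dA] by metis
  have "\<bar>v $ k\<bar> \<le> prod N UNIV" for k
  proof -
    define A' where "A' = (\<chi> i j. if j = k then b (g i) else r (g i) $ j)"
    have "(\<chi> i j. if j = k then (\<chi> i. b (g i)) $ i else A $ i $ j) = A'"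
      by (simp add: vec_eq_iff A'_def A_def)
    then have vk: "v $ k = det A' / det A"
      by (subst veq) simp
    have "det A \<in> \<int>" using int by (intro det_in_Ints) (simp add: A_def)
    then have "1 \<le> \<bar>det A\<bar>" using dA by (rule Ints_nonzero_abs_ge1)
    then have "\<bar>v $ k\<bar> \<le> \<bar>det A'\<bar>"
      by (simp add: vk divide_le_eq mult_le_cancel_left1)
    also have "\<dots> \<le> (\<Prod>i\<in>UNIV. \<Sum>j\<in>UNIV. \<bar>A' $ i $ j\<bar>)" by (rule abs_det_le_prod_row_sums)
    also have "\<dots> \<le> (\<Prod>i\<in>UNIV. N (g i))"
    proof (rule prod_mono, rule conjI)
      fix i
      show "0 \<le> (\<Sum>j\<in>UNIV. \<bar>A' $ i $ j\<bar>)" by (simp add: sum_nonneg)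
      \<comment> \<open>Column \<open>k\<close> now holds the right-hand sides, which is why
        \<open>N\<close> also counts \<open>\<bar>b c\<bar>\<close>.\<close>
      have "(\<Sum>j\<in>UNIV. \<bar>A' $ i $ j\<bar>) = \<bar>b (g i)\<bar> + (\<Sum>j\<in>UNIV-{k}. \<bar>r (g i) $ j\<bar>)"
        by (subst sum.remove[of _ k]) (auto simp: A'_def)
      also have "\<dots> \<le> \<bar>b (g i)\<bar> + (\<Sum>j\<in>UNIV. \<bar>r (g i) $ j\<bar>)"
        by (intro add_left_mono sum_mono2) auto
      also have "\<dots> \<le> N (g i)" using N(1)[of "g i"] by simp
      finally show "(\<Sum>j\<in>UNIV. \<bar>A' $ i $ j\<bar>) \<le> N (g i)" .
    qed
    \<comment> \<open>The chosen constraints are distinct, so this is a subproduct of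
      \<open>prod N UNIV\<close>, whose remaining factors are at least 1.\<close>
    also have "\<dots> = prod N (range g)" using inj by (simp add: prod.reindex)
    also have "\<dots> \<le> prod N UNIV"
    proof (rule prod_mono2)
      show "0 \<le> N c" for c using N(2)[of c] by linarith
    qed (use N(2) in auto)
    finally show ?thesis .
  qed
  with v show thesis by (rule that)
qed

section \<open>Evaluation of polynomials, and pre-fixed points\<close>

lemma poly_value_superset:
  assumes "finite A" "Poly_Mapping.keys p \<subseteq> A"
  shows "poly_value p x = (\<Sum>m\<in>A. of_rat (Poly_Mapping.lookup p m) *
           (\<Prod>j\<in>UNIV. (x $ j) ^ Poly_Mapping.lookup m j))"
  unfolding poly_value_def using assms
  by (intro sum.mono_neutral_left) (auto simp: in_keys_iff)

lemma poly_value_zero: "poly_value 0 x = 0"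
  by (simp add: poly_value_def)

lemma poly_value_add: "poly_value (p + p') x = poly_value p x + poly_value p' x"
proof -
  let ?A = "Poly_Mapping.keys p \<union> Poly_Mapping.keys p'"
  have "poly_value (p + p') x = (\<Sum>m\<in>?A. of_rat (Poly_Mapping.lookup (p + p') m) *
           (\<Prod>j\<in>UNIV. (x $ j) ^ Poly_Mapping.lookup m j))"
    by (rule poly_value_superset) (auto simp: Poly_Mapping.keys_add)
  then show ?thesis
    by (simp add: poly_value_superset[of ?A p] poly_value_superset[of ?A p'] lookup_add of_rat_add
        distrib_right sum.distrib)
qed

lemma poly_value_sum: "poly_value (\<Sum>a\<in>A. f a) x = (\<Sum>a\<in>A. poly_value (f a) x)"
  by (induction A rule: infinite_finite_induct) (auto simp: poly_value_zero poly_value_add)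

lemma poly_value_single:
  "poly_value (Poly_Mapping.single m c) x =
     of_rat c * (\<Prod>j\<in>UNIV. (x $ j) ^ Poly_Mapping.lookup m j)"
  by (subst poly_value_superset[of "{m}"]) auto

lemma prod_power_var: "(\<Prod>l\<in>UNIV. (x $ l) ^ Poly_Mapping.lookup (var j) l) = x $ j"
  for x :: "real^'n"
proof -
  have "(\<Prod>l\<in>UNIV. (x $ l) ^ Poly_Mapping.lookup (var j) l) = (\<Prod>l\<in>UNIV. if l = j then x $ l else 1)"
    by (intro prod.cong) (auto simp: var_def lookup_single when_def)
  then show ?thesis by simp
qed

lemma poly_value_quadratic:
  "poly_value (Poly_Mapping.single (var j + var k) 1) x = x $ j * x $ k"
  by (simp add: poly_value_single lookup_add power_add prod.distrib prod_power_var)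

lemma poly_value_linear:
  "poly_value ((\<Sum>j\<in>UNIV. Poly_Mapping.single (var j) (a j)) + Poly_Mapping.single 0 c) x =
     (\<Sum>j\<in>UNIV. of_rat (a j) * x $ j) + of_rat c"
  by (simp add: poly_value_add poly_value_sum poly_value_single prod_power_var)

lemma poly_value_mono:
  assumes "\<And>m. 0 \<le> Poly_Mapping.lookup p m" "\<And>j. 0 \<le> x $ j" "\<And>j. x $ j \<le> y $ j"
  shows "poly_value p x \<le> poly_value p y"
  unfolding poly_value_def using assms
  by (intro sum_mono mult_left_mono prod_mono) (auto intro: power_mono)

lemma poly_value_nonneg:
  assumes "\<And>m. 0 \<le> Poly_Mapping.lookup p m" "\<And>j. 0 \<le> x $ j"
  shows "0 \<le> poly_value p x"
  unfolding poly_value_def using assms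
  by (intro sum_nonneg mult_nonneg_nonneg prod_nonneg) auto

text \<open>Knaster--Tarski on the nonnegative orthant.\<close>

lemma LFP_le_prefixed_point:
  fixes P :: "'n::finite \<Rightarrow> 'n rpoly"
  assumes nonneg: "\<And>i m. 0 \<le> Poly_Mapping.lookup (P i) m"
    and lfp: "is_LFP P q"
    and y: "\<And>i. 0 \<le> y $ i" "\<And>i. poly_value (P i) y \<le> y $ i"
  shows "q $ i \<le> y $ i"
proof -
  define Z where "Z = {z :: real^'n. (\<forall>i. 0 \<le> z $ i) \<and> (\<forall>i. poly_value (P i) z \<le> z $ i)}"
  define u :: "real^'n" where "u = (\<chi> i. INF z\<in>Z. z $ i)"
  have yZ: "y \<in> Z" using y by (simp add: Z_def)
  have bdd: "bdd_below ((\<lambda>z. z $ i) ` Z)" for i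
    by (rule bdd_belowI[of _ 0]) (auto simp: Z_def)
  have u_le: "u $ i \<le> z $ i" if "z \<in> Z" for z i
    unfolding u_def using bdd that by (auto intro: cINF_lower)
  have u_ge: "c \<le> u $ i" if "\<And>z. z \<in> Z \<Longrightarrow> c \<le> z $ i" for c i
    unfolding u_def using that yZ by (auto intro!: cINF_greatest)
  have u0: "0 \<le> u $ i" for i by (rule u_ge) (simp add: Z_def)
  have pre: "poly_value (P i) u \<le> u $ i" for i
  proof (rule u_ge)
    fix z assume z: "z \<in> Z"
    have "poly_value (P i) u \<le> poly_value (P i) z"
      using nonneg u0 u_le[OF z] by (intro poly_value_mono)
    also have "\<dots> \<le> z $ i" using z by (simp add: Z_def)
    finally show "poly_value (P i) u \<le> z $ i" .
  qed
  \<comment> \<open>By monotonicity the image of the pre-fixed point \<open>u\<close> is again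
    pre-fixed, hence not below the infimum \<open>u\<close>; this is the missing half of the
    fixed-point equation.\<close>
  have "system_map P u \<in> Z"
    unfolding Z_def system_map_def
  proof (safe; simp)
    show v0: "0 \<le> poly_value (P i) u" for i using nonneg u0 by (rule poly_value_nonneg)
    show "poly_value (P i) (\<chi> i. poly_value (P i) u) \<le> poly_value (P i) u" for i
      using nonneg v0 pre by (intro poly_value_mono) auto
  qed
  then have "u $ i \<le> poly_value (P i) u" for i
    using u_le[of "system_map P u" i] by (simp add: system_map_def)
  with pre have "u = system_map P u"
    by (simp add: vec_eq_iff system_map_def antisym)
  then have "q $ i \<le> u $ i" using lfp u0 by (auto simp: is_LFP_def)
  also have "\<dots> \<le> y $ i" by (rule u_le[OF yZ])
  finally show ?thesis .
qed

section \<open>Encoding size and common denominators\<close>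

definition poly_size :: "'n::finite rpoly \<Rightarrow> nat" where
  "poly_size p = (\<Sum>m\<in>Poly_Mapping.keys p. rat_bits (Poly_Mapping.lookup p m) +
     (\<Sum>j\<in>Poly_Mapping.keys m. floorlog 2 (Poly_Mapping.lookup m j)))"

lemma encoding_size_eq: "encoding_size (P :: 'n::finite \<Rightarrow> 'n rpoly) = CARD('n) + (\<Sum>i\<in>UNIV. poly_size (P i))"
  by (simp add: encoding_size_def poly_size_def)

text \<open>The product of all denominators works: each lies below two to the number of its binary
  digits, and these digit counts sum to at most \<open>poly_size p\<close>.\<close>

lemma common_denominator_exists:
  obtains D :: real where "D \<in> \<int>" "1 \<le> D" "D \<le> 2 ^ poly_size p"
    "\<And>m. D * of_rat (Poly_Mapping.lookup p m) \<in> \<int>"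
proof
  define d where "d m = nat (snd (quotient_of (Poly_Mapping.lookup p m)))" for m
  define D :: real where "D = real (\<Prod>m\<in>Poly_Mapping.keys p. d m)"
  have dpos: "d m > 0" for m
    using quotient_of_denom_pos'[of "Poly_Mapping.lookup p m"] by (simp add: d_def)
  show "D \<in> \<int>" unfolding D_def by (rule Ints_of_nat)
  have "1 \<le> d m" for m using dpos[of m] by simp
  then have "1 \<le> (\<Prod>m\<in>Poly_Mapping.keys p. d m)" by (intro prod_ge_1) auto
  then show "1 \<le> D" unfolding D_def by linarith
  have "(\<Prod>m\<in>Poly_Mapping.keys p. d m) \<le> (\<Prod>m\<in>Poly_Mapping.keys p. 2 ^
     (rat_bits (Poly_Mapping.lookup p m) +
     (\<Sum>j\<in>Poly_Mapping.keys m. floorlog 2 (Poly_Mapping.lookup m j))))"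
  proof (rule prod_mono, safe)
    fix m
    have "d m < 2 ^ floorlog 2 (d m)" using floorlog_bounds[OF dpos, of 2 m] by simp
    also have "\<dots> \<le> 2 ^ (rat_bits (Poly_Mapping.lookup p m) +
     (\<Sum>j\<in>Poly_Mapping.keys m. floorlog 2 (Poly_Mapping.lookup m j)))"
      by (intro power_increasing) (auto simp: d_def rat_bits_def)
    finally show "d m \<le> 2 ^ (rat_bits (Poly_Mapping.lookup p m) +
     (\<Sum>j\<in>Poly_Mapping.keys m. floorlog 2 (Poly_Mapping.lookup m j)))" by simp
  qed
  also have "\<dots> = 2 ^ poly_size p" by (simp add: poly_size_def power_sum)
  finally have "real (\<Prod>m\<in>Poly_Mapping.keys p. d m) \<le> real (2 ^ poly_size p)" by (rule of_nat_mono)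
  then show "D \<le> 2 ^ poly_size p" by (simp add: D_def)
  fix m
  show "D * of_rat (Poly_Mapping.lookup p m) \<in> \<int>"
  proof (cases "m \<in> Poly_Mapping.keys p")
    case True
    obtain a b where ab: "quotient_of (Poly_Mapping.lookup p m) = (a, b)" by fastforce
    have "b > 0" using quotient_of_denom_pos[OF ab] .
    then have *: "of_rat (Poly_Mapping.lookup p m) = real_of_int a / real (d m)"
      using quotient_of_div[OF ab] ab by (simp add: d_def of_rat_divide)
    have "D = real (d m) * real (\<Prod>m\<in>Poly_Mapping.keys p - {m}. d m)"
      unfolding D_def by (subst prod.remove[OF _ True]) auto
    then have "D * of_rat (Poly_Mapping.lookup p m) =
      real_of_int a * real (\<Prod>m\<in>Poly_Mapping.keys p - {m}. d m)"
      using dpos[of m] by (simp add: *)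
    also have "\<dots> \<in> \<int>" by (intro Ints_mult) auto
    finally show ?thesis .
  qed (simp add: in_keys_iff)
qed

lemma var_eq_iff [simp]: "var j = var k \<longleftrightarrow> j = k"
  by (metis var_def lookup_single_eq lookup_single_not_eq zero_neq_one)

lemma var_neq_0 [simp]: "var j \<noteq> 0"
  by (metis var_def lookup_single_eq lookup_zero zero_neq_one)

text \<open>The monomials \<open>var j\<close> and \<open>0\<close> are pairwise distinct, so a
  common denominator of the coefficients of \<open>p\<close> also clears every \<open>a j\<close>
  and \<open>c\<close>.\<close>

lemma lookup_linear:
  fixes a :: "'n::finite \<Rightarrow> rat" and c :: rat
  defines "p \<equiv> (\<Sum>j\<in>UNIV. Poly_Mapping.single (var j) (a j)) + Poly_Mapping.single 0 c"
  shows "Poly_Mapping.lookup p (var k) = a k" "Poly_Mapping.lookup p 0 = c"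
  by (simp_all add: p_def lookup_add lookup_sum lookup_single when_def var_neq_0[symmetric])

section \<open>Linear constraints attached to the rows of the system\<close>

text \<open>
  The inequality \<open>b \<le> r \<bullet> v\<close> is an integer constraint of size \<open>N\<close> that is met by \<open>1 - q\<close> scaled up and
  that makes \<open>1 - v / M\<^sup>2\<close> a pre-fixed point in row \<open>i\<close>.
\<close>

definition row_constraint ::
    "'n::finite rpoly \<Rightarrow> 'n \<Rightarrow> real^'n \<Rightarrow> real^'n \<Rightarrow> real \<Rightarrow> real \<Rightarrow> bool" where
  "row_constraint p i q r b N \<longleftrightarrow>
     (\<forall>j. r $ j \<in> \<int>) \<and> b \<in> \<int> \<and> (\<Sum>j\<in>UNIV. \<bar>r $ j\<bar>) + \<bar>b\<bar> \<le> N \<and> 1 \<le> N \<and> N \<le> 2 ^ Suc (poly_size p) \<and>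
     (\<forall>\<delta>. 0 < \<delta> \<and> \<delta> \<le> 1 \<and> (\<forall>j. \<delta> \<le> 1 - q $ j) \<longrightarrow> b \<le> r \<bullet> (\<chi> j. (1 - q $ j) / \<delta>\<^sup>2)) \<and>
     (\<forall>v M. (\<forall>j. 1 \<le> v $ j \<and> v $ j \<le> M) \<and> N \<le> M \<and> b \<le> r \<bullet> v \<longrightarrow>
        poly_value p (\<chi> j. 1 - v $ j / M\<^sup>2) \<le> 1 - v $ i / M\<^sup>2)"

text \<open>For x = 1 - v / M^2 the product x_j x_k is 1 - (v_j + v_k) / M^2 + v_j v_k / M^4. As v_j
  v_k \<le> M^2, the last term is at most 1 / M^2, and the right-hand side \<open>1\<close> of the
  constraint pays for it.\<close>

lemma row_constraint_quadratic:
  fixes p :: "'n::finite rpoly"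
  assumes p: "p = Poly_Mapping.single (var j + var k) 1" and q: "poly_value p q = q $ i"
  shows "row_constraint p i q (axis j 1 + axis k 1 - axis i 1) 1 4"
proof -
  let ?r = "axis j 1 + axis k 1 - axis i 1 :: real^'n"
  have inner: "?r \<bullet> v = v $ j + v $ k - v $ i" for v
    by (simp add: inner_add_left inner_diff_left inner_axis')
  \<comment> \<open>The indices \<open>i\<close>, \<open>j\<close>, \<open>k\<close> may coincide;
    the triangle inequality gives 3 in every case.\<close>
  have "(\<Sum>l\<in>UNIV. \<bar>?r $ l\<bar>) \<le>
      (\<Sum>l\<in>UNIV. (if l = j then 1 else 0) + (if l = k then 1 else 0) + (if l = i then 1 else 0))"
    by (intro sum_mono) (auto simp: axis_def)
  also have "\<dots> = 3" by (simp add: sum.distrib)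
  finally have row: "(\<Sum>l\<in>UNIV. \<bar>?r $ l\<bar>) + \<bar>1\<bar> \<le> 4" by simp
  \<comment> \<open>The coefficient 1 occupies at least one bit, so the extra factor 2 in
    \<open>row_constraint\<close> suffices for the size 4.\<close>
  have "floorlog 2 (Suc 0) = 1" by (simp add: floorlog_def)
  then have "1 \<le> poly_size p" by (simp add: p poly_size_def rat_bits_def)
  then have "(2::real) ^ 2 \<le> 2 ^ Suc (poly_size p)" by (intro power_increasing) auto
  then have size: "4 \<le> (2::real) ^ Suc (poly_size p)" by simp
  have feas: "1 \<le> ?r \<bullet> (\<chi> j. (1 - q $ j) / \<delta>\<^sup>2)"
    if "0 < \<delta>" "\<forall>j. \<delta> \<le> 1 - q $ j" for \<delta>
  proof -
    \<comment> \<open>Since q_i = q_j q_k, the combination of complements in the constraint is the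
      product (1 - q_j)(1 - q_k). It is at least \<delta>^2, hence the scaling by 1 /
      \<delta>^2.\<close>
    have "\<delta> * \<delta> \<le> (1 - q $ j) * (1 - q $ k)"
      using that by (intro mult_mono) (auto intro: order_trans[of 0 \<delta>] less_imp_le simp del: diff_ge_0_iff_ge)
    also have "\<dots> = (1 - q $ j) + (1 - q $ k) - (1 - q $ i)"
      using q by (simp add: p poly_value_quadratic algebra_simps)
    finally have "1 \<le> ((1 - q $ j) + (1 - q $ k) - (1 - q $ i)) / \<delta>\<^sup>2"
      using that(1) by (simp add: power2_eq_square)
    then show ?thesis unfolding inner by (simp add: add_divide_distrib diff_divide_distrib)
  qed
  have step: "poly_value p (\<chi> j. 1 - v $ j / M\<^sup>2) \<le> 1 - v $ i / M\<^sup>2"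
    if v: "\<forall>j. 1 \<le> v $ j \<and> v $ j \<le> M" and "4 \<le> M" "1 \<le> ?r \<bullet> v" for v M
  proof -
    have "v $ j * v $ k \<le> M * M" using v \<open>4 \<le> M\<close> by (intro mult_mono) (auto intro: order_trans[of 0 1])
    then have "(v $ j * v $ k) / M\<^sup>2 \<le> 1" using \<open>4 \<le> M\<close> by (simp add: power2_eq_square)
    then have "v $ i + (v $ j * v $ k) / M\<^sup>2 \<le> v $ j + v $ k"
      using that(3) unfolding inner by linarith
    then have "(v $ i + (v $ j * v $ k) / M\<^sup>2) / M\<^sup>2 \<le> (v $ j + v $ k) / M\<^sup>2"
      by (rule divide_right_mono) simp
    then show ?thesis
      by (simp add: p poly_value_quadratic algebra_simps add_divide_distrib)
  qed
  show ?thesis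
    unfolding row_constraint_def using row size feas step by (auto simp: axis_def)
qed

text \<open>With f the defect of the coefficient sum from 1, the row demands v_i / M^2 \<le> f +
  (\<Sum>j. \<alpha>_j v_j / M^2). If f = 0, the factor 1 / M^2 cancels. If f > 0, then D f is a
  positive integer, so v_i / M^2 \<le> 1 / M \<le> 1 / D \<le> f.\<close>

lemma row_constraint_linear:
  fixes p :: "'n::finite rpoly"
  assumes a: "\<And>j. 0 \<le> a j" "(\<Sum>j\<in>UNIV. a j) + c \<le> 1"
    and c: "0 \<le> c"
    and p: "p = (\<Sum>j\<in>UNIV. Poly_Mapping.single (var j) (a j)) + Poly_Mapping.single 0 c"
    and q: "poly_value p q = q $ i"
  shows "\<exists>r b N. row_constraint p i q r b N"
proof -
  define \<alpha> :: "'n \<Rightarrow> real" where "\<alpha> j = of_rat (a j)" for j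
  define f where "f = 1 - (\<Sum>j\<in>UNIV. a j) - c"
  have f0: "0 \<le> f" using a(2) by (simp add: f_def)
  have \<alpha>0: "0 \<le> \<alpha> j" for j using a(1) by (simp add: \<alpha>_def)
  have c_eq: "(of_rat c :: real) = 1 - of_rat f - (\<Sum>j\<in>UNIV. \<alpha> j)"
    by (simp add: f_def \<alpha>_def of_rat_diff of_rat_sum)
  have val: "poly_value p x = 1 - of_rat f - (\<Sum>j\<in>UNIV. \<alpha> j * (1 - x $ j))" for x
    by (simp add: p poly_value_linear flip: \<alpha>_def) (simp add: c_eq right_diff_distrib sum_subtractf)
  obtain D :: real where D: "D \<in> \<int>" "1 \<le> D" "D \<le> 2 ^ poly_size p"
    and int: "\<And>m. D * of_rat (Poly_Mapping.lookup p m) \<in> \<int>"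
    using common_denominator_exists[of p] by blast
  have \<alpha>_int: "D * \<alpha> j \<in> \<int>" for j using int[of "var j"] by (simp add: p lookup_linear \<alpha>_def)
  have c_int: "D * of_rat c \<in> \<int>" using int[of 0] by (simp add: p lookup_linear)
  have size: "2 * D \<le> 2 ^ Suc (poly_size p)" using D(3) by simp
  show ?thesis
  proof (cases "f = 0")
    case True
    \<comment> \<open>The factor \<open>D\<close> clears denominators. Since the \<alpha>_j sum to
      at most 1, the absolute entries sum to at most \<open>2 * D\<close>, one \<open>D\<close>
      being due to the term for \<open>i\<close>.\<close>
    define r where "r = (\<chi> j. D * \<alpha> j - (if j = i then D else 0))"
    have inner: "r \<bullet> v = D * ((\<Sum>j\<in>UNIV. \<alpha> j * v $ j) - v $ i)" for v
      by (simp add: r_def inner_vec_def left_diff_distrib sum_subtractf sum_distrib_left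
          right_diff_distrib mult.assoc if_distrib[of "\<lambda>x. x * _"] cong: if_cong)
    have "(\<Sum>j\<in>UNIV. \<bar>r $ j\<bar>) \<le> (\<Sum>j\<in>UNIV. D * \<alpha> j + (if j = i then D else 0))"
    proof (rule sum_mono)
      fix j
      have "0 \<le> D * \<alpha> j" using D(2) \<alpha>0 by simp
      then show "\<bar>r $ j\<bar> \<le> D * \<alpha> j + (if j = i then D else 0)"
        using D(2) by (simp add: r_def abs_le_iff)
    qed
    also have "\<dots> = D * (\<Sum>j\<in>UNIV. \<alpha> j) + D" by (simp add: sum.distrib sum_distrib_left)
    also have "\<dots> \<le> D * 1 + D"
      using D(2) c_eq c True zero_le_of_rat_iff[of c, where 'a = real]
      by (intro add_right_mono mult_left_mono) auto
    finally have row: "(\<Sum>j\<in>UNIV. \<bar>r $ j\<bar>) + \<bar>0\<bar> \<le> 2 * D" by simp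
    have feas: "0 \<le> r \<bullet> (\<chi> j. (1 - q $ j) / \<delta>\<^sup>2)" for \<delta>
    proof -
      have "(\<Sum>j\<in>UNIV. \<alpha> j * (1 - q $ j)) = 1 - q $ i" using val[of q] q True by simp
      then show ?thesis by (simp add: inner flip: sum_divide_distrib)
    qed
    have step: "poly_value p (\<chi> j. 1 - v $ j / M\<^sup>2) \<le> 1 - v $ i / M\<^sup>2"
      if "0 \<le> r \<bullet> v" for v M
    proof -
      have "v $ i \<le> (\<Sum>j\<in>UNIV. \<alpha> j * v $ j)"
        using that D(2) by (simp add: inner zero_le_mult_iff)
      then have "v $ i / M\<^sup>2 \<le> (\<Sum>j\<in>UNIV. \<alpha> j * v $ j) / M\<^sup>2"
        by (rule divide_right_mono) simp
      then show ?thesis by (simp add: val True sum_divide_distrib)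
    qed
    have "r $ j \<in> \<int>" for j using \<alpha>_int D(1) by (auto simp: r_def)
    then have "row_constraint p i q r 0 (2 * D)"
      unfolding row_constraint_def using row size feas step D(2) by auto
    then show ?thesis by blast
  next
    case False
    have "D * of_rat f = D - (\<Sum>j\<in>UNIV. D * \<alpha> j) - D * of_rat c"
      by (simp add: c_eq right_diff_distrib sum_distrib_left)
    also have "\<dots> \<in> \<int>" using D(1) \<alpha>_int c_int by (intro Ints_diff Ints_sum)
    finally have "D * of_rat f \<in> \<int>" .
    moreover have "0 < D * of_rat f" using False f0 D(2) by simp
    ultimately have "1 \<le> D * of_rat f"
      by (metis Ints_nonzero_abs_ge1 abs_of_pos less_numeral_extra(3))
    then have defect: "1 / D \<le> of_rat f" using D(2) by (simp add: divide_le_eq mult.commute)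
    \<comment> \<open>Some constraint must still be recorded for this row;
      \<open>1 \<le> v $ i\<close> is met by the scaled \<open>1 - q\<close> and belongs to the
      final system anyway.\<close>
    have feas: "1 \<le> axis i 1 \<bullet> (\<chi> j. (1 - q $ j) / \<delta>\<^sup>2)"
      if "0 < \<delta>" "\<delta> \<le> 1" "\<forall>j. \<delta> \<le> 1 - q $ j" for \<delta>
    proof -
      have "\<delta>\<^sup>2 \<le> \<delta>" using that(1,2) by (simp add: power2_eq_square mult_left_le)
      also have "\<dots> \<le> 1 - q $ i" using that(3) by simp
      finally show ?thesis using that(1) by (simp add: inner_axis')
    qed
    have step: "poly_value p (\<chi> j. 1 - v $ j / M\<^sup>2) \<le> 1 - v $ i / M\<^sup>2"
      if v: "\<forall>j. 1 \<le> v $ j \<and> v $ j \<le> M" and M: "2 * D \<le> M" for v M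
    proof -
      have "v $ i / M\<^sup>2 \<le> M / M\<^sup>2" using v by (intro divide_right_mono) auto
      also have "\<dots> = 1 / M" by (simp add: power2_eq_square)
      also have "\<dots> \<le> 1 / D" using M D(2) by (intro divide_left_mono) auto
      finally have "v $ i / M\<^sup>2 \<le> of_rat f" using defect by simp
      moreover have "0 \<le> (\<Sum>j\<in>UNIV. \<alpha> j * (v $ j / M\<^sup>2))"
        using v \<alpha>0 by (intro sum_nonneg mult_nonneg_nonneg divide_nonneg_nonneg) (auto intro: order_trans[of 0 1])
      ultimately show ?thesis by (simp add: val)
    qed
    have "(\<Sum>j\<in>UNIV. \<bar>axis i (1::real) $ j\<bar>) = 1"
      by (simp add: axis_def if_distrib[of abs] cong: if_cong)
    then have row: "(\<Sum>j\<in>UNIV. \<bar>axis i (1::real) $ j\<bar>) + \<bar>1\<bar> \<le> 2 * D" using D(2) by simp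
    have "row_constraint p i q (axis i 1) 1 (2 * D)"
      unfolding row_constraint_def using row size feas step D(2) by (auto simp: axis_def)
    then show ?thesis by blast
  qed
qed

section \<open>Combining the row constraints into one system and bounding its solution\<close>

theorem theorem3p12:
  fixes P :: "'n::finite \<Rightarrow> 'n rpoly" and q :: "real ^ 'n"
  assumes "PPS P"
    and "simple_normal_form P"
    and "is_LFP P q"
    and "\<forall>i. 0 < q $ i"
    and "\<forall>i. q $ i < 1"
  shows "(\<forall>i. 1 - q $ i \<ge> 2 powr (- 4 * real (encoding_size P))) \<and>
         infnorm q \<le> 1 - 2 powr (- 4 * real (encoding_size P))"
proof -
  have fixp: "poly_value (P i) q = q $ i" for i
    using assms(3) by (metis is_LFP_def system_map_def vec_lambda_beta)
  have "\<exists>r b N. row_constraint (P i) i q r b N" for i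
  proof -
    consider "quadratic_form (P i)" | "linear_form (P i)"
      using assms(2) by (auto simp: simple_normal_form_def)
    then show ?thesis
    proof cases
      case 1
      then show ?thesis
        using row_constraint_quadratic[OF _ fixp] unfolding quadratic_form_def by blast
    next
      case 2
      then show ?thesis
        using row_constraint_linear[OF _ _ _ _ fixp] unfolding linear_form_def by blast
    qed
  qed
  then obtain r b N where row: "\<And>i. row_constraint (P i) i q (r i) (b i) (N i)" by metis
  \<comment> \<open>\<open>Inl i\<close> indexes the constraint \<open>1 \<le> v $ i\<close>, and \<open>Inr i\<close> the constraint of row \<open>i\<close>.\<close>
  define r' where "r' = case_sum (\<lambda>i :: 'n. axis i 1) r"
  define b' where "b' = case_sum (\<lambda>i :: 'n. 1) b"
  define N' where "N' = case_sum (\<lambda>i :: 'n. 2) N"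
  define M where "M = prod N' UNIV"
  \<comment> \<open>The smallest complement is positive because the minimum over finitely many
    coordinates is attained. Scaling \<open>1 - q\<close> by 1 / \<delta>^2 then meets all
    constraints at once.\<close>
  define \<delta> where "\<delta> = Min (range (\<lambda>i. 1 - q $ i))"
  have \<delta>_le: "\<delta> \<le> 1 - q $ i" for i by (simp add: \<delta>_def)
  have "\<delta> \<in> range (\<lambda>i. 1 - q $ i)" unfolding \<delta>_def by (rule Min_in) auto
  then have \<delta>: "0 < \<delta>" "\<delta> \<le> 1" using assms(4,5) by (auto intro: less_imp_le)
  obtain v where v: "\<And>c. b' c \<le> r' c \<bullet> v" and v_le: "\<And>k. \<bar>v $ k\<bar> \<le> M"
    unfolding M_def
  proof (rule integer_system_small_solution[where r = r' and b = b' and N = N'])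
    \<comment> \<open>The unit vectors of the constraints \<open>1 \<le> v $ i\<close> make the rows
      span, as the existence of a vertex requires.\<close>
    have "(Basis :: (real^'n) set) \<subseteq> range r'"
      by (force simp: Basis_vec_def r'_def intro: image_eqI[where x = "Inl _"])
    then show "span (range r') = UNIV" using span_mono[of Basis "range r'"] by auto
    show "b' c \<le> r' c \<bullet> (\<chi> j. (1 - q $ j) / \<delta>\<^sup>2)" for c
    proof (cases c)
      case (Inl i)
      have "\<delta>\<^sup>2 \<le> \<delta>" using \<delta> by (simp add: power2_eq_square mult_left_le)
      also have "\<dots> \<le> 1 - q $ i" by (rule \<delta>_le)
      finally show ?thesis using \<delta> by (simp add: Inl r'_def b'_def inner_axis')
    next
      case (Inr i)
      with row[of i] \<delta> \<delta>_le show ?thesis by (simp add: row_constraint_def r'_def b'_def)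
    qed
    show "r' c $ j \<in> \<int>" "b' c \<in> \<int>" "1 \<le> N' c" for c j
      using row by (auto simp: row_constraint_def r'_def b'_def N'_def axis_def split: sum.split)
    show "(\<Sum>j\<in>UNIV. \<bar>r' c $ j\<bar>) + \<bar>b' c\<bar> \<le> N' c" for c
      using row by (auto simp: row_constraint_def r'_def b'_def N'_def axis_def if_distrib[of abs]
          split: sum.split cong: if_cong)
  qed blast
  have N_ge_1: "1 \<le> N i" for i using row by (simp add: row_constraint_def)
  then have N_nonneg: "0 \<le> N i" for i using order_trans zero_le_one by blast
  have v_ge_1: "1 \<le> v $ i" for i
    using v[of "Inl i"] by (simp add: b'_def r'_def inner_axis')
  \<comment> \<open>Each constraint \<open>1 \<le> v $ i\<close> has size 2: one for its entry and
    one for its right-hand side.\<close>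
  have M_eq: "M = 2 ^ CARD('n) * prod N UNIV"
  proof -
    have "M = prod N' (range Inl) * prod N' (range Inr)"
      unfolding M_def UNIV_sum by (rule prod.union_disjoint) auto
    then show ?thesis by (simp add: N'_def prod.reindex)
  qed
  have N_le: "N i \<le> M" for i
  proof -
    have "N i = prod N {i}" by simp
    also have "\<dots> \<le> prod N UNIV"
      by (rule prod_mono2) (auto simp: N_ge_1 N_nonneg)
    also have "\<dots> \<le> M"
      using mult_right_mono[of 1 "2 ^ CARD('n)" "prod N UNIV"] by (simp add: M_eq prod_nonneg N_nonneg)
    finally show ?thesis .
  qed
  have M_ge_1: "1 \<le> M" using N_ge_1 N_le order_trans by blast
  have M_le: "M \<le> 2 ^ (2 * encoding_size P)"
  proof -
    have "prod N UNIV \<le> (\<Prod>i\<in>UNIV. 2 ^ Suc (poly_size (P i)))"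
      using row N_nonneg by (intro prod_mono) (auto simp: row_constraint_def)
    also have "\<dots> = 2 ^ (\<Sum>i\<in>UNIV. Suc (poly_size (P i)))" by (rule power_sum[symmetric])
    \<comment> \<open>The extra bit allowed per row adds up to exactly the summand
      \<open>CARD('n)\<close> of the encoding size.\<close>
    also have "(\<Sum>i\<in>UNIV. Suc (poly_size (P i))) = encoding_size P"
      by (simp add: encoding_size_eq sum_Suc)
    finally have "M \<le> 2 ^ CARD('n) * 2 ^ encoding_size P" by (simp add: M_eq)
    also have "\<dots> = 2 ^ (CARD('n) + encoding_size P)" by (simp add: power_add)
    \<comment> \<open>The factor \<open>2 ^ CARD('n)\<close> is absorbed using
      \<open>CARD('n) \<le> encoding_size P\<close>, which doubles the exponent.\<close>
    also have "\<dots> \<le> 2 ^ (2 * encoding_size P)"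
      by (intro power_increasing) (auto simp: encoding_size_eq)
    finally show ?thesis .
  qed
  have q_le: "q $ i \<le> 1 - v $ i / M\<^sup>2" for i
  proof -
    have "q $ i \<le> (\<chi> j. 1 - v $ j / M\<^sup>2) $ i"
    proof (rule LFP_le_prefixed_point[OF _ assms(3)])
      show "0 \<le> Poly_Mapping.lookup (P i) m" for i m using assms(1) by (simp add: PPS_def)
      show "0 \<le> (\<chi> j. 1 - v $ j / M\<^sup>2) $ i" for i
      proof -
        have "v $ i \<le> M * 1" using v_le[of i] by simp
        also have "\<dots> \<le> M * M" using M_ge_1 by (intro mult_left_mono) auto
        finally show ?thesis using M_ge_1 by (simp add: power2_eq_square)
      qed
      show "poly_value (P i) (\<chi> j. 1 - v $ j / M\<^sup>2) \<le> (\<chi> j. 1 - v $ j / M\<^sup>2) $ i" for i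
        using row[of i] v_ge_1 v_le N_le[of i] v[of "Inr i"]
        by (simp add: row_constraint_def b'_def r'_def abs_le_iff)
    qed
    then show ?thesis by simp
  qed
  have bound: "2 powr (- 4 * real (encoding_size P)) \<le> 1 - q $ i" for i
  proof -
    \<comment> \<open>Squaring \<open>M\<close> doubles the exponent a second time, giving the
      constant 4; \<open>1 \<le> v $ i\<close> then turns 1 / M^2 into a lower bound for the
      complement.\<close>
    have "2 powr (- 4 * real (encoding_size P)) = 1 / 2 powr real (2 * encoding_size P * 2)"
      by (simp add: powr_minus_divide)
    also have "\<dots> = 1 / 2 ^ (2 * encoding_size P * 2)"
      by (subst powr_realpow) (rule zero_less_numeral refl)+
    also have "\<dots> = 1 / (2 ^ (2 * encoding_size P))\<^sup>2"
      by (simp only: power_mult)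
    also have "\<dots> \<le> 1 / M\<^sup>2"
      using M_le M_ge_1 by (intro divide_left_mono power_mono mult_pos_pos) auto
    also have "\<dots> \<le> v $ i / M\<^sup>2" using v_ge_1 by (intro divide_right_mono) auto
    also have "\<dots> \<le> 1 - q $ i" using q_le[of i] by simp
    finally show ?thesis .
  qed
  have "infnorm q \<le> 1 - 2 powr (- 4 * real (encoding_size P))"
    unfolding infnorm_cart
  proof (rule cSup_least)
    fix x assume "x \<in> {\<bar>q $ i\<bar> |i. i \<in> UNIV}"
    then obtain i where "x = \<bar>q $ i\<bar>" by blast
    then show "x \<le> 1 - 2 powr (- 4 * real (encoding_size P))"
      using bound[of i] assms(4) by (simp add: abs_of_pos)
  qed auto
  with bound show ?thesis by blast
qed

end
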